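(* Let $\mathcal{E}=\{p_\lambda : \lambda\in\Lambda\}$ be a full regular and steep exponential family of densities on $(\mathcal{X},\mathcal{F},\mu)$ with source parameter $\lambda\in\Lambda$, natural parameter space $\Theta\subset\mathbb{R}^D$, and bijective ordinary-to-natural parameter conversion function $\theta:\Lambda\to\Theta$. For $\alpha\in(0,1)$ and $\lambda_1,\lambda_2\in\Lambda$, put $$M_{\theta,\alpha}(\lambda_2,\lambda_1):=\theta^{-1}\left(\alpha\,\theta(\lambda_2)+(1-\alpha)\,\theta(\lambda_1)\right).$$ Then, for all $\lambda_1,\lambda_2\in\Lambda$ and every $\omega\in\mathcal{X}$, $$D_{\mathrm{KL}}[p_{\lambda_1}:p_{\lambda_2}]=\log\left(\frac{p_{\lambda_1}(\omega)}{p_{\lambda_2}(\omega)}\right)+\lim_{\alpha\to 0^+}\frac{1}{\alpha}\log\left(\frac{p_{M_{\theta,\alpha}(\lambda_2,\lambda_1)}(\omega)}{p_{\lambda_1}(\omega)}\right).$$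
   Context: $(\mathcal{X},\mathcal{F},\mu)$ is a measure space with positive measure $\mu$. An exponential family of order $D$ with source parameter $\lambda\in\Lambda$ has densities with respect to $\mu$ $$p_\lambda(x)=\exp\left(\theta(\lambda)^\top t(x)-F(\theta(\lambda))+k(x)\right),\quad x\in\mathcal{X},$$ where $t:\mathcal{X}\to\mathbb{R}^D$ is the (minimal) sufficient statistic, $k:\mathcal{X}\to\mathbb{R}$ is the carrier term, $\theta:\Lambda\to\Theta$ is a bijection (with inverse $\theta^{-1}$), and $F(\theta)=\log\int_{\mathcal{X}}\exp(\theta^\top t(x)+k(x))\,\mathrm{d}\mu(x)$ is the cumulant function. Full regular means that $\Theta$ is the set of all $\theta\in\mathbb{R}^D$ for which this integral is finite, and that it is a non-empty open convex set. Steep means that $\{E_{p_\lambda}[t(x)]:\lambda\in\Lambda\}$ equals the interior of the closed convex hull of $\{t(x):x\in\mathcal{X}\}$. All densities of the family have the same support $\mathcal{X}$ (they are strictly positive at every point of $\mathcal{X}$). The Kullback-Leibler divergence is $D_{\mathrm{KL}}[p:q]=\int_{\mathcal{X}}p(x)\log\frac{p(x)}{q(x)}\,\mathrm{d}\mu(x)$. *)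

theory Defs
  imports "HOL-Analysis.Analysis"
begin

definition cumulant :: "'a measure \<Rightarrow> ('a \<Rightarrow> real ^ 'd) \<Rightarrow> ('a \<Rightarrow> real) \<Rightarrow> real ^ 'd \<Rightarrow> real" where
  "cumulant M t k \<eta> = ln (\<integral>x. exp (\<eta> \<bullet> t x + k x) \<partial>M)"

text \<open>The integrand is positive, so (for measurable t and k) integrability means exactly that
  the integral is finite.\<close>
definition natural_domain :: "'a measure \<Rightarrow> ('a \<Rightarrow> real ^ 'd) \<Rightarrow> ('a \<Rightarrow> real) \<Rightarrow> (real ^ 'd) set" where
  "natural_domain M t k = {\<eta>. integrable M (\<lambda>x. exp (\<eta> \<bullet> t x + k x))}"

definition ef_density ::
  "'a measure \<Rightarrow> ('a \<Rightarrow> real ^ 'd) \<Rightarrow> ('a \<Rightarrow> real) \<Rightarrow> ('l \<Rightarrow> real ^ 'd) \<Rightarrow> 'l \<Rightarrow> 'a \<Rightarrow> real" where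
  "ef_density M t k \<theta> l x = exp (\<theta> l \<bullet> t x - cumulant M t k (\<theta> l) + k x)"

text \<open>Minimality of the statistic: no nontrivial affine relation between its components
  holds almost everywhere, so the order of the family cannot be reduced.\<close>
definition minimal_statistic :: "'a measure \<Rightarrow> ('a \<Rightarrow> real ^ 'd) \<Rightarrow> bool" where
  "minimal_statistic M t \<longleftrightarrow> (\<forall>u c. (AE x in M. u \<bullet> t x = c) \<longrightarrow> u = 0)"

text \<open>An exponential family of order CARD('d) with source parameter set \<open>\<Lambda>\<close>, natural
  parameter set \<open>\<Theta>\<close> and conversion function \<open>\<theta>\<close>; its densities are
  \<open>ef_density M t k \<theta> l\<close> for \<open>l \<in> \<Lambda>\<close>.\<close>
locale exponential_family =
  fixes M :: "'a measure" and t :: "'a \<Rightarrow> real ^ 'd" and k :: "'a \<Rightarrow> real"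
    and \<Lambda> :: "'l set" and \<Theta> :: "(real ^ 'd) set" and \<theta> :: "'l \<Rightarrow> real ^ 'd"
  assumes t_measurable: "t \<in> borel_measurable M"
    and k_measurable: "k \<in> borel_measurable M"
    and minimal: "minimal_statistic M t"
    and bij: "bij_betw \<theta> \<Lambda> \<Theta>"
    and finite_integral: "\<Theta> \<subseteq> natural_domain M t k"

definition full_regular ::
  "'a measure \<Rightarrow> ('a \<Rightarrow> real ^ 'd) \<Rightarrow> ('a \<Rightarrow> real) \<Rightarrow> (real ^ 'd) set \<Rightarrow> bool" where
  "full_regular M t k \<Theta> \<longleftrightarrow>
     \<Theta> = natural_domain M t k \<and> \<Theta> \<noteq> {} \<and> open \<Theta> \<and> convex \<Theta>"

definition mean_statistic ::
  "'a measure \<Rightarrow> ('a \<Rightarrow> real ^ 'd) \<Rightarrow> ('a \<Rightarrow> real) \<Rightarrow> ('l \<Rightarrow> real ^ 'd) \<Rightarrow> 'l \<Rightarrow> real ^ 'd" where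
  "mean_statistic M t k \<theta> l = (\<integral>x. ef_density M t k \<theta> l x *\<^sub>R t x \<partial>M)"

definition steep ::
  "'a measure \<Rightarrow> ('a \<Rightarrow> real ^ 'd) \<Rightarrow> ('a \<Rightarrow> real) \<Rightarrow> 'l set \<Rightarrow> ('l \<Rightarrow> real ^ 'd) \<Rightarrow> bool" where
  "steep M t k \<Lambda> \<theta> \<longleftrightarrow>
     mean_statistic M t k \<theta> ` \<Lambda> = interior (closure (convex hull (t ` space M)))"

definition quasi_arith_mean ::
  "'l set \<Rightarrow> ('l \<Rightarrow> real ^ 'd) \<Rightarrow> real \<Rightarrow> 'l \<Rightarrow> 'l \<Rightarrow> 'l" where
  "quasi_arith_mean \<Lambda> \<theta> \<alpha> l2 l1 = inv_into \<Lambda> \<theta> (\<alpha> *\<^sub>R \<theta> l2 + (1 - \<alpha>) *\<^sub>R \<theta> l1)"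

text \<open>The Bochner integral is 0 when the integrand is not integrable, so a claim about the
  value of the divergence has to be accompanied by integrability.\<close>
definition kl_integrand :: "('a \<Rightarrow> real) \<Rightarrow> ('a \<Rightarrow> real) \<Rightarrow> 'a \<Rightarrow> real" where
  "kl_integrand p q x = p x * ln (p x / q x)"

definition kl_div :: "'a measure \<Rightarrow> ('a \<Rightarrow> real) \<Rightarrow> ('a \<Rightarrow> real) \<Rightarrow> real" where
  "kl_div M p q = (\<integral>x. kl_integrand p q x \<partial>M)"

end

theory Submission
  imports Defs
begin

text \<open>
  Write \<open>\<theta>\<^sub>i\<close> for the natural parameter of \<open>l\<^sub>i\<close>, \<open>v = \<theta>\<^sub>2 - \<theta>\<^sub>1\<close> and \<open>F\<close> for the cumulant function.
  The logarithm of a ratio of two densities of the family is affine in \<open>t\<close>: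
  \<open>ln (p\<^sub>1 x / p\<^sub>2 x) = F \<theta>\<^sub>2 - F \<theta>\<^sub>1 - v \<bullet> t x\<close>. Integrating against \<open>p\<^sub>1\<close> turns
  \<open>v \<bullet> t x\<close> into the mean of \<open>v \<bullet> t\<close>, so the divergence is the value of this expression
  at \<open>x = \<omega>\<close> plus \<open>v \<bullet> t \<omega> - E\<^sub>1[v \<bullet> t]\<close>. This correction is the limit in
  the theorem: the quasi-arithmetic mean with weight \<open>\<alpha>\<close> has natural parameter
  \<open>\<theta>\<^sub>1 + \<alpha> v\<close>, so the difference quotient equals
  \<open>v \<bullet> t \<omega> - (F (\<theta>\<^sub>1 + \<alpha> v) - F \<theta>\<^sub>1) / \<alpha>\<close>, and the derivative of \<open>F\<close> at \<open>\<theta>\<^sub>1\<close> in the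
  direction \<open>v\<close> is the mean \<open>E\<^sub>1[v \<bullet> t]\<close> (lemma \<open>cumulant_has_directional_derivative\<close>).

  The derivative of \<open>F\<close> is the only analytic point. Since the natural domain is open, it contains
  \<open>\<theta>\<^sub>1 + \<delta> v\<close> and \<open>\<theta>\<^sub>1 - \<delta> v\<close> for some \<open>\<delta> > 0\<close>; the two exponentials there
  dominate the difference quotients of the integrand, and differentiation under the integral sign
  is justified (lemma \<open>laplace_integral_has_derivative\<close>). Minimality of the statistic excludes the
  zero measure, so that the logarithm in \<open>F\<close> is taken at a positive number.
\<close>

text \<open>The derivative of \<open>exp (s * y)\<close> in \<open>s\<close> produces a factor \<open>\<bar>y\<bar>\<close>. Only half of the
  room \<open>d\<close> is left to \<open>s\<close>, because the other half absorbs this factor: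
  \<open>\<bar>y\<bar> \<le> 2 / d * exp (d / 2 * \<bar>y\<bar>)\<close>.\<close>
lemma exp_difference_quotient_bound:
  fixes y s d :: real
  assumes d: "d > 0" and s: "\<bar>s\<bar> \<le> d / 2"
  shows "\<bar>exp (s * y) - 1\<bar> \<le> \<bar>s\<bar> * (2 / d * (exp (d * y) + exp (- d * y)))"
proof -
  have lip: "\<bar>exp z - 1\<bar> \<le> \<bar>z\<bar> * exp \<bar>z\<bar>" for z :: real
  proof (cases "z \<ge> 0")
    case True
    have "(1 - z) * exp z \<le> exp (- z) * exp z"
      using exp_ge_add_one_self[of "- z"] by (intro mult_right_mono) auto
    then have "exp z - z * exp z \<le> 1"
      by (simp add: algebra_simps flip: exp_add)
    then show ?thesis using True by simp
  next
    case False
    have "1 - exp z \<le> - z" using exp_ge_add_one_self[of z] by linarith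
    also have "\<dots> \<le> - z * exp (- z)" using False by (simp add: mult_le_cancel_left1)
    finally show ?thesis using False by simp
  qed
  have half: "\<bar>s * y\<bar> \<le> d / 2 * \<bar>y\<bar>"
    unfolding abs_mult using s by (intro mult_right_mono) auto
  have lin: "\<bar>y\<bar> \<le> 2 / d * exp (d / 2 * \<bar>y\<bar>)"
    using exp_ge_add_one_self[of "d / 2 * \<bar>y\<bar>"] d by (simp add: field_simps)
  have "\<bar>exp (s * y) - 1\<bar> \<le> \<bar>s\<bar> * (\<bar>y\<bar> * exp \<bar>s * y\<bar>)"
    using lip[of "s * y"] by (simp add: abs_mult mult.assoc)
  also have "\<dots> \<le> \<bar>s\<bar> * ((2 / d * exp (d / 2 * \<bar>y\<bar>)) * exp (d / 2 * \<bar>y\<bar>))"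
    using lin half d by (intro mult_left_mono mult_mono) auto
  also have "\<dots> = \<bar>s\<bar> * (2 / d * exp (d * \<bar>y\<bar>))"
    by (simp flip: exp_add)
  also have "\<dots> \<le> \<bar>s\<bar> * (2 / d * (exp (d * y) + exp (- d * y)))"
    using d by (intro mult_left_mono) (auto simp: abs_if)
  finally show ?thesis .
qed

text \<open>Dominated convergence: the bound on the difference quotients of \<open>s \<mapsto> exp (s * y x)\<close>
  is uniform in \<open>s\<close> and integrable against \<open>w\<close> by assumption. Letting \<open>s\<close> tend to \<open>0\<close> in it also
  bounds \<open>y\<close>, whence the integrability of the derivative.\<close>
lemma laplace_integral_has_derivative:
  fixes y w :: "'a \<Rightarrow> real"
  assumes [measurable]: "y \<in> borel_measurable M" "w \<in> borel_measurable M"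
    and w: "\<And>x. w x \<ge> 0" and d: "d > 0"
    and int_w: "integrable M w"
    and int_pos: "integrable M (\<lambda>x. exp (d * y x) * w x)"
    and int_neg: "integrable M (\<lambda>x. exp (- d * y x) * w x)"
  shows "integrable M (\<lambda>x. y x * w x)"
    and "((\<lambda>s. \<integral>x. exp (s * y x) * w x \<partial>M) has_real_derivative (\<integral>x. y x * w x \<partial>M)) (at 0)"
proof -
  define B where "B x = 2 / d * (exp (d * y x) + exp (- d * y x)) * w x" for x
  have int_B: "integrable M B"
  proof -
    have "integrable M (\<lambda>x. 2 / d * (exp (d * y x) * w x + exp (- d * y x) * w x))"
      using int_pos int_neg by auto
    then show ?thesis
      by (rule back_subst[of "integrable M"]) (auto simp: B_def fun_eq_iff algebra_simps)
  qed
  have quotient: "\<bar>(exp (s * y x) - 1) / s * w x\<bar> \<le> B x" if "s \<noteq> 0" "\<bar>s\<bar> \<le> d / 2" for s x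
  proof -
    have "\<bar>(exp (s * y x) - 1) / s\<bar> \<le> 2 / d * (exp (d * y x) + exp (- d * y x))"
      using exp_difference_quotient_bound[OF d that(2), of "y x"] that(1)
      by (simp add: abs_divide divide_le_eq mult.commute)
    then show ?thesis unfolding B_def abs_mult abs_of_nonneg[OF w]
      by (rule mult_right_mono[OF _ w])
  qed
  have pointwise: "((\<lambda>s. (exp (s * y x) - 1) / s * w x) \<longlongrightarrow> y x * w x) (at 0)" for x
  proof -
    have "((\<lambda>s. exp (s * y x)) has_real_derivative y x) (at 0)"
      by (auto intro!: derivative_eq_intros)
    then have "((\<lambda>s. (exp (s * y x) - 1) / s) \<longlongrightarrow> y x) (at 0)"
      by (simp add: has_field_derivative_iff)
    then show ?thesis by (intro tendsto_mult tendsto_const)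
  qed
  have near: "\<forall>\<^sub>F s in at (0::real). s \<noteq> 0 \<and> \<bar>s\<bar> \<le> d / 2"
    using d by (auto simp: eventually_at intro!: exI[of _ "d / 2"])
  have dominated: "\<bar>y x * w x\<bar> \<le> B x" for x
  proof (rule tendsto_upperbound)
    show "((\<lambda>s. \<bar>(exp (s * y x) - 1) / s * w x\<bar>) \<longlongrightarrow> \<bar>y x * w x\<bar>) (at 0)"
      by (intro tendsto_rabs pointwise)
    show "\<forall>\<^sub>F s in at 0. \<bar>(exp (s * y x) - 1) / s * w x\<bar> \<le> B x"
      using near by eventually_elim (use quotient in blast)
  qed simp
  show "integrable M (\<lambda>x. y x * w x)"
    using dominated by (intro Bochner_Integration.integrable_bound[OF int_B]) (auto intro!: AE_I2 order_trans[OF _ abs_ge_self])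
  have int_quot: "integrable M (\<lambda>x. (exp (s * y x) - 1) / s * w x)"
    if "s \<noteq> 0" "\<bar>s\<bar> \<le> d / 2" for s
    using quotient[OF that]
    by (intro Bochner_Integration.integrable_bound[OF int_B]) (auto intro!: AE_I2 order_trans[OF _ abs_ge_self])
  have int_exp: "(\<integral>x. exp (s * y x) * w x \<partial>M) - (\<integral>x. w x \<partial>M)
      = s * (\<integral>x. (exp (s * y x) - 1) / s * w x \<partial>M)" if "s \<noteq> 0" "\<bar>s\<bar> \<le> d / 2" for s
  proof -
    have eq: "exp (s * y x) * w x = s * ((exp (s * y x) - 1) / s * w x) + w x" for x
      using that(1) by (simp add: field_simps)
    have "(\<integral>x. exp (s * y x) * w x \<partial>M)
        = (\<integral>x. s * ((exp (s * y x) - 1) / s * w x) + w x \<partial>M)"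
      by (subst eq) (rule refl)
    also have "\<dots> = s * (\<integral>x. (exp (s * y x) - 1) / s * w x \<partial>M) + (\<integral>x. w x \<partial>M)"
      using int_quot[OF that] int_w
      by (subst Bochner_Integration.integral_add) (auto simp del: times_divide_eq_left)
    finally show ?thesis by simp
  qed
  have "((\<lambda>s. \<integral>x. (exp (s * y x) - 1) / s * w x \<partial>M) \<longlongrightarrow> (\<integral>x. y x * w x \<partial>M)) (at 0)"
    unfolding tendsto_at_iff_sequentially comp_def
  proof (intro allI impI)
    fix S :: "nat \<Rightarrow> real"
    assume S: "\<forall>i. S i \<in> UNIV - {0}" "S \<longlonglongrightarrow> 0"
    then have S_at: "filterlim S (at 0) sequentially"
      by (auto simp: filterlim_at)
    have "\<forall>\<^sub>F n in sequentially. \<bar>S n\<bar> \<le> d / 2"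
      using eventually_compose_filterlim[OF near S_at] by eventually_elim simp
    \<comment> \<open>The bound holds only for small parameters, so the first \<open>N\<close> terms are dropped.\<close>
    then obtain N where N: "\<And>n. n \<ge> N \<Longrightarrow> \<bar>S n\<bar> \<le> d / 2"
      by (auto simp: eventually_sequentially)
    have "(\<lambda>n. \<integral>x. (exp (S (n + N) * y x) - 1) / S (n + N) * w x \<partial>M)
        \<longlonglongrightarrow> (\<integral>x. y x * w x \<partial>M)"
    proof (rule integral_dominated_convergence[OF _ _ int_B])
      show "AE x in M. (\<lambda>n. (exp (S (n + N) * y x) - 1) / S (n + N) * w x)
          \<longlonglongrightarrow> y x * w x"
        by (intro AE_I2 LIMSEQ_ignore_initial_segment filterlim_compose[OF pointwise S_at])
      show "AE x in M. norm ((exp (S (n + N) * y x) - 1) / S (n + N) * w x) \<le> B x" for n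
        using quotient[of "S (n + N)"] N[of "n + N"] S(1) by simp
    qed measurable
    then show "(\<lambda>n. \<integral>x. (exp (S n * y x) - 1) / S n * w x \<partial>M)
        \<longlonglongrightarrow> (\<integral>x. y x * w x \<partial>M)"
      by (rule LIMSEQ_offset)
  qed
  moreover have "\<forall>\<^sub>F s in at 0. (\<integral>x. (exp (s * y x) - 1) / s * w x \<partial>M)
      = ((\<integral>x. exp (s * y x) * w x \<partial>M) - (\<integral>x. w x \<partial>M)) / s"
    using near by eventually_elim (simp add: int_exp del: times_divide_eq_left)
  ultimately have "((\<lambda>s. ((\<integral>x. exp (s * y x) * w x \<partial>M) - (\<integral>x. w x \<partial>M)) / s)
      \<longlongrightarrow> (\<integral>x. y x * w x \<partial>M)) (at 0)"
    by (rule Lim_transform_eventually)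
  then show "((\<lambda>s. \<integral>x. exp (s * y x) * w x \<partial>M) has_real_derivative (\<integral>x. y x * w x \<partial>M)) (at 0)"
    by (simp add: has_field_derivative_iff)
qed

text \<open>A vanishing integral of a positive function forces the zero measure, for which every
  affine relation holds almost everywhere.\<close>
lemma minimal_statistic_partition_pos:
  fixes t :: "'a \<Rightarrow> real ^ 'd"
  assumes "minimal_statistic M t" and "\<eta> \<in> natural_domain M t k"
  shows "(\<integral>x. exp (\<eta> \<bullet> t x + k x) \<partial>M) > 0"
proof (rule ccontr)
  assume "\<not> ?thesis"
  moreover have "(\<integral>x. exp (\<eta> \<bullet> t x + k x) \<partial>M) \<ge> 0"
    by (intro Bochner_Integration.integral_nonneg) simp
  ultimately have "(\<integral>x. exp (\<eta> \<bullet> t x + k x) \<partial>M) = 0" by simp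
  then have "AE x in M. exp (\<eta> \<bullet> t x + k x) = 0"
    using assms(2) by (subst (asm) integral_nonneg_eq_0_iff_AE) (auto simp: natural_domain_def)
  then have "AE x in M. (1 :: real ^ 'd) \<bullet> t x = 0"
    by (rule eventually_mono) simp
  then have "(1 :: real ^ 'd) = 0"
    using assms(1) unfolding minimal_statistic_def by blast
  then show False by simp
qed

lemma integral_ef_density:
  fixes M t k
  assumes "minimal_statistic M t" and "\<theta> l \<in> natural_domain M t k"
  shows "integrable M (ef_density M t k \<theta> l)" and "(\<integral>x. ef_density M t k \<theta> l x \<partial>M) = 1"
proof -
  define Z where "Z = (\<integral>x. exp (\<theta> l \<bullet> t x + k x) \<partial>M)"
  have Z: "Z > 0" unfolding Z_def by (rule minimal_statistic_partition_pos[OF assms])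
  have density: "ef_density M t k \<theta> l = (\<lambda>x. exp (\<theta> l \<bullet> t x + k x) / Z)"
    using Z by (simp add: fun_eq_iff ef_density_def cumulant_def exp_add exp_diff Z_def)
  show "integrable M (ef_density M t k \<theta> l)" "(\<integral>x. ef_density M t k \<theta> l x \<partial>M) = 1"
    using assms(2) Z by (simp_all add: density natural_domain_def Z_def)
qed

text \<open>The gradient of the cumulant function is the mean of the sufficient statistic; only the
  derivative along a line through an interior point of the natural domain is considered.\<close>
lemma cumulant_has_directional_derivative:
  fixes M :: "'a measure" and t :: "'a \<Rightarrow> real ^ 'd" and v :: "real ^ 'd"
  assumes [measurable]: "t \<in> borel_measurable M" "k \<in> borel_measurable M"
    and min: "minimal_statistic M t" and inner: "\<theta> l \<in> interior (natural_domain M t k)"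
  shows "integrable M (\<lambda>x. ef_density M t k \<theta> l x * (v \<bullet> t x))"
    and "((\<lambda>s. cumulant M t k (\<theta> l + s *\<^sub>R v)) has_real_derivative
           (\<integral>x. ef_density M t k \<theta> l x * (v \<bullet> t x) \<partial>M)) (at 0)"
proof -
  define w where "w x = exp (\<theta> l \<bullet> t x + k x)" for x
  define Z where "Z = (\<integral>x. w x \<partial>M)"
  have dom: "\<theta> l \<in> natural_domain M t k" using inner interior_subset by blast
  have Z: "Z > 0" unfolding Z_def w_def by (rule minimal_statistic_partition_pos[OF min dom])
  have shift: "exp ((\<theta> l + s *\<^sub>R v) \<bullet> t x + k x) = exp (s * (v \<bullet> t x)) * w x" for s x
    by (simp add: w_def inner_add_left algebra_simps flip: exp_add)
  have density: "ef_density M t k \<theta> l x = w x / Z" for x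
    using Z by (simp add: ef_density_def cumulant_def exp_add exp_diff Z_def w_def)
  have "((\<lambda>s. \<theta> l + s *\<^sub>R v) \<longlongrightarrow> \<theta> l + 0 *\<^sub>R v) (at 0)" by (intro tendsto_intros)
  then have "\<forall>\<^sub>F s in at 0. \<theta> l + s *\<^sub>R v \<in> interior (natural_domain M t k)"
    using inner by (intro topological_tendstoD) auto
  then obtain r where r: "r > 0" and
    near: "\<And>s. s \<noteq> 0 \<Longrightarrow> \<bar>s\<bar> < r \<Longrightarrow> \<theta> l + s *\<^sub>R v \<in> natural_domain M t k"
    unfolding eventually_at dist_real_def using interior_subset by fastforce
  have int: "integrable M (\<lambda>x. exp (s * (v \<bullet> t x)) * w x)" if "s \<noteq> 0" "\<bar>s\<bar> < r" for s
    using near[OF that] by (simp add: natural_domain_def shift)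
  have deriv: "integrable M (\<lambda>x. (v \<bullet> t x) * w x)"
    "((\<lambda>s. \<integral>x. exp (s * (v \<bullet> t x)) * w x \<partial>M) has_real_derivative
       (\<integral>x. (v \<bullet> t x) * w x \<partial>M)) (at 0)"
  proof -
    have meas: "(\<lambda>x. v \<bullet> t x) \<in> borel_measurable M" "w \<in> borel_measurable M"
      unfolding w_def by measurable
    have w: "integrable M w" "\<And>x. w x \<ge> 0"
      using dom by (simp_all add: natural_domain_def w_def[abs_def])
    have ends: "integrable M (\<lambda>x. exp (r / 2 * (v \<bullet> t x)) * w x)"
      "integrable M (\<lambda>x. exp (- (r / 2) * (v \<bullet> t x)) * w x)"
      using int[of "r / 2"] int[of "- (r / 2)"] r by auto
    have "r / 2 > 0" using r by simp
    note laplace = laplace_integral_has_derivative[OF meas w(2) this w(1) ends]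
    show "integrable M (\<lambda>x. (v \<bullet> t x) * w x)"
      "((\<lambda>s. \<integral>x. exp (s * (v \<bullet> t x)) * w x \<partial>M) has_real_derivative
         (\<integral>x. (v \<bullet> t x) * w x \<partial>M)) (at 0)"
      by (fact laplace)+
  qed
  have mean: "ef_density M t k \<theta> l x * (v \<bullet> t x) = (v \<bullet> t x) * w x / Z" for x
    by (simp add: density)
  show "integrable M (\<lambda>x. ef_density M t k \<theta> l x * (v \<bullet> t x))"
    unfolding mean using deriv(1) by simp
  have "((\<lambda>s. ln (\<integral>x. exp (s * (v \<bullet> t x)) * w x \<partial>M)) has_real_derivative
      1 / Z * (\<integral>x. (v \<bullet> t x) * w x \<partial>M)) (at 0)"
    by (rule DERIV_chain2[OF _ deriv(2)])
      (use Z in \<open>auto intro!: derivative_eq_intros simp: Z_def\<close>)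
  then show "((\<lambda>s. cumulant M t k (\<theta> l + s *\<^sub>R v)) has_real_derivative
      (\<integral>x. ef_density M t k \<theta> l x * (v \<bullet> t x) \<partial>M)) (at 0)"
    by (simp add: cumulant_def shift mean)
qed

lemma ln_ef_density_ratio:
  "ln (ef_density M t k \<theta> l x / ef_density M t k \<theta> l' x)
     = (\<theta> l - \<theta> l') \<bullet> t x - (cumulant M t k (\<theta> l) - cumulant M t k (\<theta> l'))"
  by (simp add: ef_density_def inner_diff_left flip: exp_diff)

theorem mainTheorem3:
  fixes M :: "'a measure" and t :: "'a \<Rightarrow> real ^ 'd" and k :: "'a \<Rightarrow> real"
    and \<Lambda> :: "'l set" and \<Theta> :: "(real ^ 'd) set" and \<theta> :: "'l \<Rightarrow> real ^ 'd"
    and l1 l2 :: 'l and \<omega> :: 'a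
  assumes "exponential_family M t k \<Lambda> \<Theta> \<theta>"
    and "full_regular M t k \<Theta>"
    and "steep M t k \<Lambda> \<theta>"
    and "l1 \<in> \<Lambda>" and "l2 \<in> \<Lambda>" and "\<omega> \<in> space M"
  shows "integrable M (kl_integrand (ef_density M t k \<theta> l1) (ef_density M t k \<theta> l2)) \<and>
    (\<exists>L. ((\<lambda>\<alpha>. 1 / \<alpha> * ln (ef_density M t k \<theta> (quasi_arith_mean \<Lambda> \<theta> \<alpha> l2 l1) \<omega>
                                / ef_density M t k \<theta> l1 \<omega>)) \<longlongrightarrow> L) (at_right 0) \<and>
      kl_div M (ef_density M t k \<theta> l1) (ef_density M t k \<theta> l2)
        = ln (ef_density M t k \<theta> l1 \<omega> / ef_density M t k \<theta> l2 \<omega>) + L)"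
proof -
  interpret exponential_family M t k \<Lambda> \<Theta> \<theta> by fact
  define v where "v = \<theta> l2 - \<theta> l1"
  define F where "F = cumulant M t k"
  define p where "p = ef_density M t k \<theta> l1"
  define m where "m = (\<integral>x. p x * (v \<bullet> t x) \<partial>M)"
  have dom: "\<Theta> = natural_domain M t k" "open \<Theta>" "convex \<Theta>"
    using assms(2) by (auto simp: full_regular_def)
  have in_\<Theta>: "\<theta> l1 \<in> \<Theta>" "\<theta> l2 \<in> \<Theta>"
    using bij assms(4,5) by (auto simp: bij_betw_def)
  then have "\<theta> l1 \<in> interior (natural_domain M t k)"
    using dom by (simp add: interior_open)
  note deriv = cumulant_has_directional_derivative
    [where \<theta> = \<theta> and l = l1 and v = v, OF t_measurable k_measurable minimal this,
      folded p_def, folded m_def F_def]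
  have p: "integrable M p" "(\<integral>x. p x \<partial>M) = 1"
    unfolding p_def using integral_ef_density[OF minimal] in_\<Theta>(1) dom(1) by simp_all
  have integrand: "kl_integrand p (ef_density M t k \<theta> l2)
      = (\<lambda>x. (F (\<theta> l2) - F (\<theta> l1)) * p x - p x * (v \<bullet> t x))"
    by (simp add: fun_eq_iff kl_integrand_def p_def ln_ef_density_ratio F_def v_def
        inner_diff_left algebra_simps)
  have int: "integrable M (kl_integrand p (ef_density M t k \<theta> l2))"
    unfolding integrand using p(1) deriv(1) by auto
  have kl: "kl_div M p (ef_density M t k \<theta> l2) = F (\<theta> l2) - F (\<theta> l1) - m"
    unfolding kl_div_def integrand using p deriv(1) by (simp add: m_def)
  let ?Q = "\<lambda>\<alpha>. 1 / \<alpha> * ln (ef_density M t k \<theta> (quasi_arith_mean \<Lambda> \<theta> \<alpha> l2 l1) \<omega> / p \<omega>)"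
  have quotient: "v \<bullet> t \<omega> - (F (\<theta> l1 + \<alpha> *\<^sub>R v) - F (\<theta> l1)) / \<alpha> = ?Q \<alpha>"
    if \<alpha>: "0 < \<alpha>" "\<alpha> < 1" for \<alpha>
  proof -
    have "\<alpha> *\<^sub>R \<theta> l2 + (1 - \<alpha>) *\<^sub>R \<theta> l1 \<in> \<Theta>"
      using \<alpha> in_\<Theta> dom(3) by (intro convexD) auto
    then have "\<theta> (quasi_arith_mean \<Lambda> \<theta> \<alpha> l2 l1) = \<alpha> *\<^sub>R \<theta> l2 + (1 - \<alpha>) *\<^sub>R \<theta> l1"
      unfolding quasi_arith_mean_def using bij by (intro f_inv_into_f) (auto simp: bij_betw_def)
    also have "\<dots> = \<theta> l1 + \<alpha> *\<^sub>R v" by (simp add: v_def algebra_simps)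
    finally show ?thesis using \<alpha>(1)
      by (simp add: p_def ln_ef_density_ratio F_def right_diff_distrib diff_divide_distrib)
  qed
  have "((\<lambda>\<alpha>. (F (\<theta> l1 + \<alpha> *\<^sub>R v) - F (\<theta> l1)) / \<alpha>) \<longlongrightarrow> m) (at_right 0)"
    using deriv(2) by (auto simp: has_field_derivative_iff intro: tendsto_within_subset)
  then have "((\<lambda>\<alpha>. v \<bullet> t \<omega> - (F (\<theta> l1 + \<alpha> *\<^sub>R v) - F (\<theta> l1)) / \<alpha>)
      \<longlongrightarrow> v \<bullet> t \<omega> - m) (at_right 0)"
    by (intro tendsto_diff tendsto_const)
  moreover have "\<forall>\<^sub>F \<alpha> in at_right 0.
      v \<bullet> t \<omega> - (F (\<theta> l1 + \<alpha> *\<^sub>R v) - F (\<theta> l1)) / \<alpha> = ?Q \<alpha>"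
    unfolding eventually_at_right_field using quotient by (intro exI[of _ 1]) auto
  ultimately have lim: "(?Q \<longlongrightarrow> v \<bullet> t \<omega> - m) (at_right 0)"
    by (rule Lim_transform_eventually)
  have "kl_div M p (ef_density M t k \<theta> l2)
      = ln (p \<omega> / ef_density M t k \<theta> l2 \<omega>) + (v \<bullet> t \<omega> - m)"
    unfolding kl by (simp add: p_def ln_ef_density_ratio F_def v_def inner_diff_left)
  then show ?thesis
    using int lim unfolding p_def by blast
qed

end
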